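(* Let $K$ be a non-trivial semiring, and let $\varphi:\mathcal P\to\mathcal M(K):a\mapsto\overline a$. For all $n\in\mathbb N$ and $a,b\in\mathcal P$ we have: (i) $\overline a=\overline b\ \Rightarrow\ a=b$; (ii) $\overline{\iota_n}=I_{2^n}$; (iii) $\overline{a^*}=\overline a^{\,T}$; (iv) $\overline{a\oplus b}=\overline a\otimes\overline b$.
   Context: **Partitions.** $\mathbb N=\{0,1,2,\ldots\}$, $[n]=\{1,\ldots,n\}$; $A'$ denotes a disjoint copy of $A\subseteq\mathbb N$. $\mathcal P_{m,n}$ is the set of all set partitions of $[m]\cup[n]'$, and $\mathcal P=\bigcup_{m,n\in\mathbb N}\mathcal P_{m,n}$ (a morphism $a\in\mathcal P_{m,n}$ carries its domain $m$ and range $n$); the elements of $a$ are called $a$-blocks. $\iota_n=\{\{i,i'\}:i\in[n]\}\in\mathcal P_{n,n}$. For $a\in\mathcal P_{m,n}$, $a^*\in\mathcal P_{n,m}$ is obtained by swapping $i\leftrightarrow i'$. For $a\in\mathcal P_{m,n}$, $b\in\mathcal P_{s,t}$, $a\oplus b\in\mathcal P_{m+s,n+t}$ has as blocks all $a$-blocks, together with $(X+m)\cup(Y+n)'$ for each $b$-block $X\cup Y'$ ($X\subseteq[s]$, $Y\subseteq[t]$). **Matrices.** A semiring $(K,+,\cdot,0,1)$ has $(K,+,0)$ a commutative monoid, $(K,\cdot,1)$ a monoid, distributivity, and $0$ a multiplicative zero; non-trivial means $0\ne1$. $\mathcal M(K)$ is the collection of all matrices over $K$ (of sizes $m\times n$,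 $m,n\in\mathbb N$); $I_k$ is the $k\times k$ identity matrix, $^T$ is transpose. For $a\in\mathcal P_{m,n}$, $\overline a$ is the $2^m\times2^n$ matrix over $K$ with rows and columns indexed by subsets of $[m]$ and $[n]$, given by $\overline a_{X,Y}=1$ if $X\cup Y'$ is a (possibly empty) union of $a$-blocks, and $0$ otherwise. For a matrix $A$ indexed by subsets of $[m]$ and $[n]$ and a matrix $B$ indexed by subsets of $[s]$ and $[t]$, the Kronecker product $A\otimes B$ is indexed by subsets of $[m+s]$ and $[n+t]$ via $(A\otimes B)_{X\cup(U+m),\,Y\cup(V+n)}=A_{X,Y}B_{U,V}$ for $X\subseteq[m]$, $U\subseteq[s]$, $Y\subseteq[n]$, $V\subseteq[t]$. *)

theory Defs
  imports
    "HOL-Library.Disjoint_Sets"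
    "HOL-Library.Nat_Bijection"
    "Jordan_Normal_Form.Matrix"
begin

section \<open>The category of set partitions\<close>

text \<open>
  The element \<open>i\<close> of \<open>[m]\<close> is represented by \<open>Inl i\<close>, and the element \<open>j'\<close> of \<open>[n]'\<close> by
  \<open>Inr j\<close>; hence \<open>X <+> Y\<close> is the set usually written \<open>X \<union> Y'\<close>.
\<close>

typedef partition =
  "{(m :: nat, n :: nat, P :: (nat + nat) set set). partition_on ({1..m} <+> {1..n}) P}"
  by (rule exI[of _ "(0, 0, {})"]) (auto simp: partition_on_def)

setup_lifting type_definition_partition

lift_definition domain :: "partition \<Rightarrow> nat" is "\<lambda>(m, n, P). m" .

lift_definition range_of :: "partition \<Rightarrow> nat" is "\<lambda>(m, n, P). n" .

lift_definition blocks :: "partition \<Rightarrow> (nat + nat) set set" is "\<lambda>(m, n, P). P" .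

lemma partition_on_blocks: "partition_on ({1..domain a} <+> {1..range_of a}) (blocks a)"
  by transfer auto

lemma partition_eqI:
  "domain a = domain b \<Longrightarrow> range_of a = range_of b \<Longrightarrow> blocks a = blocks b \<Longrightarrow> a = b"
  by transfer auto

lemma ex_partition:
  assumes "partition_on ({1..m} <+> {1..n}) P"
  shows "\<exists>a. domain a = m \<and> range_of a = n \<and> blocks a = P"
proof -
  have "(m, n, P) \<in> {(m, n, P). partition_on ({1..m} <+> {1..n}) P}" using assms by simp
  then show ?thesis
    by (intro exI[of _ "Abs_partition (m, n, P)"])
       (simp add: domain.rep_eq range_of.rep_eq blocks.rep_eq Abs_partition_inverse)
qed

lift_definition iota :: "nat \<Rightarrow> partition" is
  "\<lambda>n. (n, n, {{Inl i, Inr i} | i. i \<in> {1..n}})"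
proof (clarsimp)
  fix n :: nat
  have "{{Inl i, Inr i} | i. Suc 0 \<le> i \<and> i \<le> n} = (\<lambda>i. {Inl i, Inr i}) ` {Suc 0..n}"
    by auto
  then show "partition_on ({Suc 0..n} <+> {Suc 0..n}) {{Inl i, Inr i} | i. Suc 0 \<le> i \<and> i \<le> n}"
    by (auto simp: partition_on_def disjoint_def)
qed

fun swap_sum :: "'a + 'b \<Rightarrow> 'b + 'a" where
  "swap_sum (Inl x) = Inr x"
| "swap_sum (Inr y) = Inl y"

lemma partition_on_inj_image':
  assumes "partition_on A P" "inj_on f A"
  shows "partition_on (f ` A) ((`) f ` P)"
proof -
  have "{} \<notin> (`) f ` P" using assms(1) by (auto simp: partition_on_def)
  then show ?thesis using partition_on_inj_image[OF assms] by simp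
qed

lift_definition star :: "partition \<Rightarrow> partition" is
  "\<lambda>(m, n, P). (n, m, (`) swap_sum ` P)"
proof (clarsimp)
  fix m n :: nat and P :: "(nat + nat) set set"
  assume P: "partition_on ({Suc 0..m} <+> {Suc 0..n}) P"
  have inj: "inj_on swap_sum ({Suc 0..m} <+> {Suc 0..n})"
    by (auto simp: inj_on_def)
  have "swap_sum ` ({Suc 0..m} <+> {Suc 0..n}) = {Suc 0..n} <+> {Suc 0..m}"
    by (force simp: image_iff)
  with partition_on_inj_image'[OF P inj]
  show "partition_on ({Suc 0..n} <+> {Suc 0..m}) ((`) swap_sum ` P)" by simp
qed

lemma partition_on_Un_disjnt:
  assumes "partition_on A P" "partition_on B Q" "disjnt A B"
  shows "partition_on (A \<union> B) (P \<union> Q)"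
proof (rule partition_onI)
  fix p q assume pq: "p \<in> P \<union> Q" "q \<in> P \<union> Q" "p \<noteq> q"
  have sub: "r \<subseteq> A" if "r \<in> P" for r using that assms(1) by (auto simp: partition_on_def)
  have sub': "r \<subseteq> B" if "r \<in> Q" for r using that assms(2) by (auto simp: partition_on_def)
  have 1: "disjnt p q" if "p \<in> P" "q \<in> P"
    using partition_onD2[OF assms(1)] that pq(3) by (simp add: pairwiseD)
  have 2: "disjnt p q" if "p \<in> Q" "q \<in> Q"
    using partition_onD2[OF assms(2)] that pq(3) by (simp add: pairwiseD)
  have 3: "disjnt p q" if "p \<in> P" "q \<in> Q"
    using sub[OF that(1)] sub'[OF that(2)] assms(3) by (auto simp: disjnt_def)
  have 4: "disjnt p q" if "p \<in> Q" "q \<in> P"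
    using sub'[OF that(1)] sub[OF that(2)] assms(3) by (auto simp: disjnt_def)
  from pq(1,2) 1 2 3 4 show "disjnt p q" by blast
qed (use assms in \<open>auto simp: partition_on_def\<close>)

lemma map_sum_image_Plus: "map_sum f g ` (A <+> B) = f ` A <+> g ` B"
  by (simp add: Plus_def image_Un image_image)

text \<open>
  The map \<open>map_sum ((+) m) ((+) n)\<close> takes \<open>X <+> Y\<close> to
  \<open>(X + m) \<union> (Y + n)'\<close>.
\<close>

lift_definition oplus :: "partition \<Rightarrow> partition \<Rightarrow> partition" (infixl \<open>\<oplus>\<^sub>P\<close> 65) is
  "\<lambda>(m, n, P) (s, t, Q). (m + s, n + t, P \<union> (`) (map_sum ((+) m) ((+) n)) ` Q)"
proof (clarsimp)
  fix m n s t :: nat and P Q :: "(nat + nat) set set"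
  let ?f = "map_sum ((+) m) ((+) n)"
  let ?A = "{Suc 0..m} <+> {Suc 0..n}" and ?B = "{Suc 0..s} <+> {Suc 0..t}"
  assume P: "partition_on ?A P" and Q: "partition_on ?B Q"
  have inj: "inj_on ?f ?B" by (auto simp: inj_on_def)
  have im: "?f ` ?B = {m + 1..m + s} <+> {n + 1..n + t}"
  proof -
    have "(+) m ` {Suc 0..s} = {m + 1..m + s}" "(+) n ` {Suc 0..t} = {n + 1..n + t}"
      by simp_all
    moreover have "?f ` ?B = ((+) m ` {Suc 0..s}) <+> ((+) n ` {Suc 0..t})"
      by (rule map_sum_image_Plus)
    ultimately show ?thesis by (simp only:)
  qed
  have Q': "partition_on ({m + 1..m + s} <+> {n + 1..n + t}) ((`) ?f ` Q)"
    using partition_on_inj_image'[OF Q inj] im by simp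
  have "disjnt ?A ({m + 1..m + s} <+> {n + 1..n + t})"
    by (auto simp: disjnt_def)
  moreover have "?A \<union> ({m + 1..m + s} <+> {n + 1..n + t}) = {Suc 0..m + s} <+> {Suc 0..n + t}"
  proof -
    have "{Suc 0..m} \<union> {m + 1..m + s} = {Suc 0..m + s}"
      "{Suc 0..n} \<union> {n + 1..n + t} = {Suc 0..n + t}" by auto
    then show ?thesis unfolding Plus_def by blast
  qed
  ultimately show "partition_on ({Suc 0..m + s} <+> {Suc 0..n + t}) (P \<union> (`) ?f ` Q)"
    using partition_on_Un_disjnt[OF P Q'] by simp
qed


section \<open>Matrices indexed by subsets\<close>

text \<open>
  Library matrices have rows and columns numbered from \<open>0\<close>, so an enumeration of the subsets of
  \<open>[m]\<close> has to be chosen.  We let \<open>X \<subseteq> [m]\<close> have number \<open>\<Sum>i\<in>X. 2 ^ (m - i)\<close>, that is, the number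
  whose binary expansion, padded to \<open>m\<close> digits, is the characteristic sequence of \<open>X\<close>.  With this
  choice the Kronecker product of subset-indexed matrices is the usual Kronecker product of
  matrices; see \<open>kronecker_subset_index\<close> below.
\<close>

definition subset_index :: "nat \<Rightarrow> nat set \<Rightarrow> nat" where
  "subset_index m X = (\<Sum>i\<in>X. 2 ^ (m - i))"

definition index_subset :: "nat \<Rightarrow> nat \<Rightarrow> nat set" where
  "index_subset m k = {i \<in> {1..m}. odd (k div 2 ^ (m - i))}"

definition union_of_blocks :: "partition \<Rightarrow> nat set \<Rightarrow> nat set \<Rightarrow> bool" where
  "union_of_blocks a X Y \<longleftrightarrow> (\<exists>C \<subseteq> blocks a. X <+> Y = \<Union>C)"

definition bar :: "partition \<Rightarrow> 'k::semiring_1 mat" where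
  "bar a = mat (2 ^ domain a) (2 ^ range_of a)
     (\<lambda>(k, l). if union_of_blocks a (index_subset (domain a) k) (index_subset (range_of a) l)
               then 1 else 0)"

definition kronecker :: "'k::semiring_1 mat \<Rightarrow> 'k mat \<Rightarrow> 'k mat" (infixl \<open>\<otimes>\<^sub>K\<close> 70) where
  "A \<otimes>\<^sub>K B = mat (dim_row A * dim_row B) (dim_col A * dim_col B)
     (\<lambda>(k, l). A $$ (k div dim_row B, l div dim_col B) * B $$ (k mod dim_row B, l mod dim_col B))"

lemma subset_index_eq_set_encode:
  assumes "X \<subseteq> {1..m}"
  shows "subset_index m X = set_encode ((-) m ` X)"
proof -
  have "inj_on ((-) m) X"
  proof (rule inj_onI)
    fix i j assume "i \<in> X" "j \<in> X" "m - i = m - j"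
    moreover from this have "i \<le> m" "j \<le> m" using assms by auto
    ultimately show "i = j" by simp
  qed
  then show ?thesis by (simp add: subset_index_def set_encode_def sum.reindex)
qed

lemma index_subset_subset_index:
  assumes "X \<subseteq> {1..m}"
  shows "index_subset m (subset_index m X) = X"
proof -
  have fin: "finite ((-) m ` X)" using assms finite_subset by blast
  have "index_subset m (subset_index m X) = {i \<in> {1..m}. m - i \<in> (-) m ` X}"
    using set_encode_inverse[OF fin]
    by (auto simp: index_subset_def subset_index_eq_set_encode[OF assms] set_decode_def)
  also have "\<dots> = X"
  proof -
    have "i = j" if "i \<in> {1..m}" "j \<in> {1..m}" "m - i = m - j" for i j using that by auto
    then show ?thesis using assms by blast
  qed
  finally show ?thesis .
qed

lemma subset_index_index_subset:
  assumes "k < 2 ^ m"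
  shows "subset_index m (index_subset m k) = k"
proof -
  have "(-) m ` index_subset m k = set_decode k"
  proof (intro equalityI subsetI)
    fix j assume j: "j \<in> set_decode k"
    have "j < m"
    proof (rule ccontr)
      assume "\<not> j < m"
      then have "(2::nat) ^ m \<le> 2 ^ j" by simp
      then have "k div 2 ^ j = 0" using assms by (intro div_less) linarith
      then show False using j by (simp add: set_decode_def)
    qed
    then show "j \<in> (-) m ` index_subset m k"
      using j by (intro image_eqI[of _ _ "m - j"]) (auto simp: index_subset_def set_decode_def)
  qed (auto simp: index_subset_def set_decode_def)
  moreover have "index_subset m k \<subseteq> {1..m}" by (auto simp: index_subset_def)
  ultimately show ?thesis by (simp add: subset_index_eq_set_encode)
qed

lemma subset_index_less:
  assumes "X \<subseteq> {1..m}"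
  shows "subset_index m X < 2 ^ m"
proof -
  have "subset_index m X \<le> subset_index m {1..m}"
    unfolding subset_index_def using assms by (intro sum_mono2) auto
  also have "\<dots> = (\<Sum>j<m. 2 ^ j)"
    unfolding subset_index_def
    by (rule sum.reindex_bij_witness[of _ "\<lambda>j. m - j" "\<lambda>i. m - i"]) auto
  also have "\<dots> < 2 ^ m" by (induction m) auto
  finally show ?thesis .
qed

lemma bij_betw_subset_index: "bij_betw (subset_index m) (Pow {1..m}) {..<2 ^ m}"
  by (rule bij_betw_byWitness[where f' = "index_subset m"])
     (auto simp: index_subset_subset_index subset_index_index_subset subset_index_less,
      auto simp: index_subset_def)

lemma bar_subset_index:
  assumes "X \<subseteq> {1..domain a}" "Y \<subseteq> {1..range_of a}"
  shows "bar a $$ (subset_index (domain a) X, subset_index (range_of a) Y) =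
           (if union_of_blocks a X Y then 1 else 0)"
  using assms by (simp add: bar_def subset_index_less index_subset_subset_index)

lemma subset_index_Un:
  assumes "X \<subseteq> {1..m}" "U \<subseteq> {1..s}"
  shows "subset_index (m + s) (X \<union> (+) m ` U) = subset_index m X * 2 ^ s + subset_index s U"
proof -
  have fin: "finite X" "finite U" using assms finite_subset by blast+
  have "X \<inter> (+) m ` U = {}" using assms by force
  then have "subset_index (m + s) (X \<union> (+) m ` U) =
      (\<Sum>i\<in>X. 2 ^ (m + s - i)) + (\<Sum>i\<in>(+) m ` U. 2 ^ (m + s - i))"
    unfolding subset_index_def using fin by (intro sum.union_disjoint) auto
  also have "(\<Sum>i\<in>X. 2 ^ (m + s - i)) = (\<Sum>i\<in>X. 2 ^ (m - i) * (2 :: nat) ^ s)"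
    using assms(1) by (intro sum.cong) (auto simp flip: power_add)
  also have "\<dots> = subset_index m X * 2 ^ s"
    by (simp add: subset_index_def sum_distrib_right)
  also have "(\<Sum>i\<in>(+) m ` U. 2 ^ (m + s - i)) = subset_index s U"
    by (simp add: subset_index_def sum.reindex)
  finally show ?thesis .
qed

lemma kronecker_subset_index:
  fixes A B :: "'k::semiring_1 mat"
  assumes A: "A \<in> carrier_mat (2 ^ m) (2 ^ n)" and B: "B \<in> carrier_mat (2 ^ s) (2 ^ t)"
    and "X \<subseteq> {1..m}" "U \<subseteq> {1..s}" "Y \<subseteq> {1..n}" "V \<subseteq> {1..t}"
  shows "(A \<otimes>\<^sub>K B) $$ (subset_index (m + s) (X \<union> (+) m ` U), subset_index (n + t) (Y \<union> (+) n ` V)) =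
           A $$ (subset_index m X, subset_index n Y) * B $$ (subset_index s U, subset_index t V)"
proof -
  have less: "subset_index (m + s) (X \<union> (+) m ` U) < 2 ^ m * 2 ^ s"
    "subset_index (n + t) (Y \<union> (+) n ` V) < 2 ^ n * 2 ^ t"
    unfolding power_add[symmetric] using assms(3-6)
    by (intro subset_index_less; fastforce)+
  have "subset_index s U < 2 ^ s" "subset_index t V < 2 ^ t"
    using assms(4,6) by (simp_all only: subset_index_less)
  then show ?thesis
    using A B less assms(3-6) by (simp add: kronecker_def subset_index_Un)
qed

end

theory Submission
  imports Defs
begin

text \<open>
  Two matrices whose rows and columns are numbered by subsets are equal as soon as they agree at
  all pairs of subsets (\<open>eq_matI_subset_index\<close>), and the entry of \<open>bar a\<close> at \<open>(X, Y)\<close> records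
  whether \<open>X <+> Y\<close> is a union of blocks of \<open>a\<close>.  Each of the four claims thereby becomes one
  about which sets are unions of blocks.

  Faithfulness holds because the blocks of a partition are the minimal non-empty unions of its
  blocks (\<open>partition_on_eqI_unions\<close>); the sizes of \<open>bar a\<close> recover the domain and range, and
  \<open>0 \<noteq> 1\<close> makes the entries recover the unions.  For the identity, a union of the blocks
  \<open>{i, i'}\<close> is precisely a set \<open>X <+> X\<close>.  The involution relabels the points by the bijection
  \<open>swap_sum\<close>, which carries \<open>X <+> Y\<close> to \<open>Y <+> X\<close>.  For the direct sum, the blocks of \<open>a\<close> and
  the shifted blocks of \<open>b\<close> live on disjoint sets, so a union of blocks of \<open>a \<oplus>\<^sub>P b\<close> splits
  independently into a part from \<open>a\<close> and a part from \<open>b\<close> (\<open>union_of_blocks_oplus\<close>); the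
  conjunction of the two conditions is the product of the two \<open>0\<close>-\<open>1\<close> entries.
\<close>

section \<open>Entries at pairs of subsets\<close>

lemma eq_matI_subset_index:
  assumes A: "A \<in> carrier_mat (2 ^ m) (2 ^ n)" and B: "B \<in> carrier_mat (2 ^ m) (2 ^ n)"
    and eq: "\<And>X Y. X \<subseteq> {1..m} \<Longrightarrow> Y \<subseteq> {1..n} \<Longrightarrow>
      A $$ (subset_index m X, subset_index n Y) = B $$ (subset_index m X, subset_index n Y)"
  shows "A = B"
proof (rule eq_matI)
  fix k l assume "k < dim_row B" "l < dim_col B"
  then have k: "k < 2 ^ m" and l: "l < 2 ^ n" using B by auto
  have "index_subset m k \<subseteq> {1..m}" "index_subset n l \<subseteq> {1..n}"
    by (auto simp: index_subset_def)
  from eq[OF this] show "A $$ (k, l) = B $$ (k, l)"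
    by (simp add: subset_index_index_subset[OF k] subset_index_index_subset[OF l])
qed (use A B in auto)

lemma bar_carrier: "(bar a :: 'k::semiring_1 mat) \<in> carrier_mat (2 ^ domain a) (2 ^ range_of a)"
  by (simp add: bar_def)

section \<open>Recovering a partition from the unions of its blocks\<close>

text \<open>
  Start from a block \<open>p\<close> of \<open>P\<close>.  Being a non-empty union of blocks of \<open>Q\<close>, it contains a block
  \<open>q\<close> of \<open>Q\<close>; for the same reason \<open>q\<close> contains a block of \<open>P\<close>, which lies inside \<open>p\<close> and hence
  is \<open>p\<close>.  So \<open>p = q\<close>.
\<close>

lemma partition_on_subset_of_unions:
  assumes P: "partition_on A P" and Q: "partition_on A Q"
    and PQ: "\<And>p. p \<in> P \<Longrightarrow> \<exists>C \<subseteq> Q. p = \<Union>C" and QP: "\<And>q. q \<in> Q \<Longrightarrow> \<exists>C \<subseteq> P. q = \<Union>C"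
  shows "P \<subseteq> Q"
proof
  fix p assume p: "p \<in> P"
  then have "p \<noteq> {}" using partition_onD3[OF P] by auto
  then obtain q where q: "q \<in> Q" "q \<subseteq> p" using PQ[OF p] by blast
  then have "q \<noteq> {}" using partition_onD3[OF Q] by auto
  then obtain r where r: "r \<in> P" "r \<subseteq> q" using QP[OF q(1)] by blast
  then have "r \<noteq> {}" using partition_onD3[OF P] by auto
  then have "\<not> disjnt p r" using r q by (auto simp: disjnt_def)
  then have "r = p" using pairwiseD[OF partition_onD2[OF P] p r(1)] by auto
  then show "p \<in> Q" using q r by auto
qed

lemma partition_on_eqI_unions:
  assumes P: "partition_on A P" and Q: "partition_on A Q"
    and eq: "\<And>S. S \<subseteq> A \<Longrightarrow> (\<exists>C \<subseteq> P. S = \<Union>C) \<longleftrightarrow> (\<exists>C \<subseteq> Q. S = \<Union>C)"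
  shows "P = Q"
proof -
  have PQ: "\<exists>C \<subseteq> Q. p = \<Union>C" if "p \<in> P" for p
  proof -
    have "p \<subseteq> A" using that partition_onD1[OF P] by auto
    moreover have "\<exists>C \<subseteq> P. p = \<Union>C" using that by (intro exI[of _ "{p}"]) auto
    ultimately show ?thesis using eq by simp
  qed
  have QP: "\<exists>C \<subseteq> P. q = \<Union>C" if "q \<in> Q" for q
  proof -
    have "q \<subseteq> A" using that partition_onD1[OF Q] by auto
    moreover have "\<exists>C \<subseteq> Q. q = \<Union>C" using that by (intro exI[of _ "{q}"]) auto
    ultimately show ?thesis using eq by simp
  qed
  show ?thesis
    using partition_on_subset_of_unions[OF P Q PQ QP] partition_on_subset_of_unions[OF Q P QP PQ]
    by blast
qed

lemma bar_inject:
  assumes eq: "(bar a :: 'k::semiring_1 mat) = bar b"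
  shows "a = b"
proof (rule partition_eqI)
  have "dim_row (bar a :: 'k mat) = dim_row (bar b :: 'k mat)"
    "dim_col (bar a :: 'k mat) = dim_col (bar b :: 'k mat)"
    by (simp_all only: eq)
  then show dom: "domain a = domain b" and ran: "range_of a = range_of b"
    by (simp_all add: bar_def)
  show "blocks a = blocks b"
  proof (rule partition_on_eqI_unions[OF partition_on_blocks])
    show "partition_on ({1..domain a} <+> {1..range_of a}) (blocks b)"
      unfolding dom ran by (rule partition_on_blocks)
  next
    fix S assume S: "S \<subseteq> {1..domain a} <+> {1..range_of a}"
    define X Y where "X = Inl -` S" and "Y = Inr -` S"
    have XY: "X \<subseteq> {1..domain a}" "Y \<subseteq> {1..range_of a}" using S by (auto simp: X_def Y_def)
    have "x \<in> S \<longleftrightarrow> x \<in> X <+> Y" for x by (cases x) (auto simp: X_def Y_def)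
    then have S_eq: "S = X <+> Y" by blast
    have "(if union_of_blocks a X Y then 1 else 0 :: 'k) = (if union_of_blocks b X Y then 1 else 0)"
      using bar_subset_index[of X a Y, where 'a = 'k] bar_subset_index[of X b Y, where 'a = 'k]
        XY eq dom ran by simp
    then have "union_of_blocks a X Y \<longleftrightarrow> union_of_blocks b X Y" by (simp split: if_splits)
    then show "(\<exists>C \<subseteq> blocks a. S = \<Union>C) \<longleftrightarrow> (\<exists>C \<subseteq> blocks b. S = \<Union>C)"
      by (simp add: union_of_blocks_def S_eq)
  qed
qed

section \<open>Identities\<close>

lemma union_of_blocks_iota:
  assumes "X \<subseteq> {1..n}" "Y \<subseteq> {1..n}"
  shows "union_of_blocks (iota n) X Y \<longleftrightarrow> X = Y"
proof
  assume "union_of_blocks (iota n) X Y"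
  then obtain C where C: "C \<subseteq> {{Inl i, Inr i} | i. i \<in> {1..n}}" and eq: "X <+> Y = \<Union>C"
    unfolding union_of_blocks_def iota.rep_eq blocks.rep_eq by auto
  have "i \<in> X \<longleftrightarrow> i \<in> Y" for i
  proof -
    have "Inl i \<in> \<Union>C \<longleftrightarrow> Inr i \<in> \<Union>C" using C by blast
    then show ?thesis unfolding eq[symmetric] by auto
  qed
  then show "X = Y" by blast
next
  assume "X = Y"
  then have "X <+> Y = \<Union>((\<lambda>i. {Inl i, Inr i}) ` X)" by auto
  moreover have "(\<lambda>i. {Inl i, Inr i}) ` X \<subseteq> blocks (iota n)"
    using assms(1) unfolding iota.rep_eq blocks.rep_eq by fastforce
  ultimately show "union_of_blocks (iota n) X Y" unfolding union_of_blocks_def by blast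
qed

lemma domain_iota [simp]: "domain (iota n) = n"
  and range_of_iota [simp]: "range_of (iota n) = n"
  by (transfer; simp)+

lemma bar_iota: "(bar (iota n) :: 'k::semiring_1 mat) = 1\<^sub>m (2 ^ n)"
proof (rule eq_matI_subset_index)
  show "(bar (iota n) :: 'k mat) \<in> carrier_mat (2 ^ n) (2 ^ n)"
    using bar_carrier[of "iota n"] by simp
  fix X Y assume XY: "X \<subseteq> {1..n}" "Y \<subseteq> {1..n}"
  have "subset_index n X = subset_index n Y \<longleftrightarrow> X = Y"
    using XY index_subset_subset_index by metis
  then show "(bar (iota n) :: 'k mat) $$ (subset_index n X, subset_index n Y) =
      1\<^sub>m (2 ^ n) $$ (subset_index n X, subset_index n Y)"
    using bar_subset_index[of X "iota n" Y, where 'a = 'k] XY union_of_blocks_iota[OF XY]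
    by (simp add: subset_index_less)
qed simp

section \<open>The involution\<close>

lemma ex_union_image_iff:
  assumes "inj f"
  shows "(\<exists>C \<subseteq> (`) f ` P. f ` S = \<Union>C) \<longleftrightarrow> (\<exists>C \<subseteq> P. S = \<Union>C)"
proof -
  have eq: "f ` S = \<Union>((`) f ` C) \<longleftrightarrow> S = \<Union>C" for C
    using inj_image_eq_iff[OF assms] by (simp flip: image_Union)
  show ?thesis
  proof
    assume "\<exists>C \<subseteq> (`) f ` P. f ` S = \<Union>C"
    then obtain D where "D \<subseteq> P" "f ` S = \<Union>((`) f ` D)" by (metis subset_imageE)
    then show "\<exists>C \<subseteq> P. S = \<Union>C" unfolding eq by blast
  next
    assume "\<exists>C \<subseteq> P. S = \<Union>C"
    then obtain D where "D \<subseteq> P" "f ` S = \<Union>((`) f ` D)" unfolding eq by blast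
    then show "\<exists>C \<subseteq> (`) f ` P. f ` S = \<Union>C"
      by (intro exI[of _ "(`) f ` D"]) (simp add: image_mono)
  qed
qed

lemma domain_star [simp]: "domain (star a) = range_of a"
  and range_of_star [simp]: "range_of (star a) = domain a"
  and blocks_star: "blocks (star a) = (`) swap_sum ` blocks a"
  by (transfer; auto)+

lemma union_of_blocks_star: "union_of_blocks (star a) X Y \<longleftrightarrow> union_of_blocks a Y X"
proof -
  have "swap_sum (swap_sum z) = z" for z :: "nat + nat" by (cases z) auto
  then have "inj (swap_sum :: nat + nat \<Rightarrow> nat + nat)" by (metis injI)
  moreover have "X <+> Y = swap_sum ` (Y <+> X)" by (auto simp: Plus_def image_Un image_image)
  ultimately show ?thesis
    by (simp add: union_of_blocks_def blocks_star ex_union_image_iff)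
qed

lemma bar_star: "(bar (star a) :: 'k::semiring_1 mat) = transpose_mat (bar a)"
proof (rule eq_matI_subset_index)
  show "(bar (star a) :: 'k mat) \<in> carrier_mat (2 ^ range_of a) (2 ^ domain a)"
    using bar_carrier[of "star a"] by simp
  show "transpose_mat (bar a :: 'k mat) \<in> carrier_mat (2 ^ range_of a) (2 ^ domain a)"
    using bar_carrier[of a] by simp
  fix X Y assume XY: "X \<subseteq> {1..range_of a}" "Y \<subseteq> {1..domain a}"
  then have "subset_index (range_of a) X < dim_col (bar a :: 'k mat)"
    "subset_index (domain a) Y < dim_row (bar a :: 'k mat)"
    by (simp_all add: bar_def subset_index_less)
  then show "(bar (star a) :: 'k mat) $$ (subset_index (range_of a) X, subset_index (domain a) Y) =
      transpose_mat (bar a) $$ (subset_index (range_of a) X, subset_index (domain a) Y)"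
    using bar_subset_index[of X "star a" Y, where 'a = 'k]
      bar_subset_index[of Y a X, where 'a = 'k] XY
    by (simp add: union_of_blocks_star)
qed

section \<open>Direct sums\<close>

text \<open>
  A union of members of \<open>P \<union> Q\<close> splits into the members taken from \<open>P\<close> and those taken from \<open>Q\<close>,
  and disjointness of \<open>A\<close> and \<open>B\<close> lets each part be read off by intersecting.
\<close>

lemma ex_union_disjnt_iff:
  assumes PA: "\<Union>P \<subseteq> A" and QB: "\<Union>Q \<subseteq> B" and AB: "disjnt A B" and "S \<subseteq> A" "T \<subseteq> B"
  shows "(\<exists>C \<subseteq> P \<union> Q. S \<union> T = \<Union>C) \<longleftrightarrow> (\<exists>C \<subseteq> P. S = \<Union>C) \<and> (\<exists>C \<subseteq> Q. T = \<Union>C)"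
proof
  assume "\<exists>C \<subseteq> P \<union> Q. S \<union> T = \<Union>C"
  then obtain C where C: "C \<subseteq> P \<union> Q" and eq: "S \<union> T = \<Union>C" by blast
  have "\<Union>C = \<Union>(C \<inter> P) \<union> \<Union>(C \<inter> Q)" using C by blast
  moreover have "\<Union>(C \<inter> P) \<subseteq> A" "\<Union>(C \<inter> Q) \<subseteq> B" using PA QB by blast+
  moreover have "S = S' \<and> T = T'"
    if "S \<union> T = S' \<union> T'" "S' \<subseteq> A" "T' \<subseteq> B" for S' T'
  proof -
    have "S = (S \<union> T) \<inter> A" "T = (S \<union> T) \<inter> B" using AB assms(4,5) by (auto simp: disjnt_iff)
    moreover have "S' = (S' \<union> T') \<inter> A" "T' = (S' \<union> T') \<inter> B"
      using AB that(2,3) by (auto simp: disjnt_iff)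
    ultimately show ?thesis using that(1) by simp
  qed
  ultimately have "S = \<Union>(C \<inter> P)" "T = \<Union>(C \<inter> Q)" using eq by simp_all
  then show "(\<exists>C \<subseteq> P. S = \<Union>C) \<and> (\<exists>C \<subseteq> Q. T = \<Union>C)" by blast
next
  assume "(\<exists>C \<subseteq> P. S = \<Union>C) \<and> (\<exists>C \<subseteq> Q. T = \<Union>C)"
  then obtain C D where "C \<subseteq> P" "S = \<Union>C" "D \<subseteq> Q" "T = \<Union>D" by blast
  then show "\<exists>C \<subseteq> P \<union> Q. S \<union> T = \<Union>C" by (intro exI[of _ "C \<union> D"]) auto
qed

lemma domain_oplus [simp]: "domain (a \<oplus>\<^sub>P b) = domain a + domain b"
  and range_of_oplus [simp]: "range_of (a \<oplus>\<^sub>P b) = range_of a + range_of b"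
  and blocks_oplus: "blocks (a \<oplus>\<^sub>P b) =
    blocks a \<union> (`) (map_sum ((+) (domain a)) ((+) (range_of a))) ` blocks b"
  by (transfer; auto)+

lemma union_of_blocks_oplus:
  assumes "X \<subseteq> {1..domain a}" "U \<subseteq> {1..domain b}" "Y \<subseteq> {1..range_of a}" "V \<subseteq> {1..range_of b}"
  shows "union_of_blocks (a \<oplus>\<^sub>P b) (X \<union> (+) (domain a) ` U) (Y \<union> (+) (range_of a) ` V) \<longleftrightarrow>
    union_of_blocks a X Y \<and> union_of_blocks b U V"
proof -
  let ?f = "map_sum ((+) (domain a)) ((+) (range_of a))"
  let ?A = "{1..domain a} <+> {1..range_of a}" and ?B = "{1..domain b} <+> {1..range_of b}"
  have split: "(X \<union> (+) (domain a) ` U) <+> (Y \<union> (+) (range_of a) ` V) =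
      (X <+> Y) \<union> ?f ` (U <+> V)"
    unfolding map_sum_image_Plus by auto
  have "\<Union>(blocks a) \<subseteq> ?A"
    using partition_onD1[OF partition_on_blocks[of a]] by simp
  moreover have "\<Union>((`) ?f ` blocks b) \<subseteq> ?f ` ?B"
    using partition_onD1[OF partition_on_blocks[of b]] by (simp flip: image_Union)
  moreover have "disjnt ?A (?f ` ?B)"
    unfolding map_sum_image_Plus disjnt_def by auto
  moreover have "X <+> Y \<subseteq> ?A" "?f ` (U <+> V) \<subseteq> ?f ` ?B"
    using assms by (auto intro!: image_mono)
  ultimately have "union_of_blocks (a \<oplus>\<^sub>P b) (X \<union> (+) (domain a) ` U) (Y \<union> (+) (range_of a) ` V)
      \<longleftrightarrow> (\<exists>C \<subseteq> blocks a. X <+> Y = \<Union>C) \<and> (\<exists>C \<subseteq> (`) ?f ` blocks b. ?f ` (U <+> V) = \<Union>C)"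
    unfolding union_of_blocks_def blocks_oplus split by (rule ex_union_disjnt_iff)
  moreover have "inj ?f" by (intro sum.inj_map) auto
  ultimately show ?thesis by (simp add: union_of_blocks_def ex_union_image_iff)
qed

lemma subset_atLeastAtMost_add_cases:
  fixes m s :: nat
  assumes "Z \<subseteq> {1..m + s}"
  obtains X U where "X \<subseteq> {1..m}" "U \<subseteq> {1..s}" "Z = X \<union> (+) m ` U"
proof
  show "Z = (Z \<inter> {1..m}) \<union> (+) m ` {i \<in> {1..s}. m + i \<in> Z}"
  proof (intro equalityI subsetI)
    fix z assume z: "z \<in> Z"
    show "z \<in> (Z \<inter> {1..m}) \<union> (+) m ` {i \<in> {1..s}. m + i \<in> Z}"
    proof (cases "z \<le> m")
      case True
      then show ?thesis using z assms by auto
    next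
      case False
      then have "z = m + (z - m)" "z - m \<in> {i \<in> {1..s}. m + i \<in> Z}" using z assms by auto
      then show ?thesis by blast
    qed
  qed auto
qed auto

lemma bar_oplus: "(bar (a \<oplus>\<^sub>P b) :: 'k::semiring_1 mat) = bar a \<otimes>\<^sub>K bar b"
proof (rule eq_matI_subset_index)
  let ?m = "domain a" and ?n = "range_of a" and ?s = "domain b" and ?t = "range_of b"
  show "(bar (a \<oplus>\<^sub>P b) :: 'k mat) \<in> carrier_mat (2 ^ (?m + ?s)) (2 ^ (?n + ?t))"
    using bar_carrier[of "a \<oplus>\<^sub>P b"] by simp
  show "(bar a \<otimes>\<^sub>K bar b :: 'k mat) \<in> carrier_mat (2 ^ (?m + ?s)) (2 ^ (?n + ?t))"
    by (simp add: kronecker_def bar_def power_add)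
  fix Z W assume Z: "Z \<subseteq> {1..?m + ?s}" and W: "W \<subseteq> {1..?n + ?t}"
  obtain X U where XU: "X \<subseteq> {1..?m}" "U \<subseteq> {1..?s}" "Z = X \<union> (+) ?m ` U"
    by (rule subset_atLeastAtMost_add_cases[OF Z])
  obtain Y V where YV: "Y \<subseteq> {1..?n}" "V \<subseteq> {1..?t}" "W = Y \<union> (+) ?n ` V"
    by (rule subset_atLeastAtMost_add_cases[OF W])
  have "(bar (a \<oplus>\<^sub>P b) :: 'k mat) $$ (subset_index (?m + ?s) Z, subset_index (?n + ?t) W) =
      (if union_of_blocks a X Y \<and> union_of_blocks b U V then 1 else 0)"
    using bar_subset_index[of Z "a \<oplus>\<^sub>P b" W, where 'a = 'k] Z W
      union_of_blocks_oplus[OF XU(1,2) YV(1,2)] XU(3) YV(3) by simp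
  also have "\<dots> = bar a $$ (subset_index ?m X, subset_index ?n Y) *
      bar b $$ (subset_index ?s U, subset_index ?t V)"
    unfolding bar_subset_index[OF XU(1) YV(1)] bar_subset_index[OF XU(2) YV(2)] by simp
  also have "\<dots> = (bar a \<otimes>\<^sub>K bar b) $$ (subset_index (?m + ?s) Z, subset_index (?n + ?t) W)"
    unfolding XU(3) YV(3)
    by (rule kronecker_subset_index[OF bar_carrier bar_carrier XU(1,2) YV(1,2), symmetric])
  finally show "(bar (a \<oplus>\<^sub>P b) :: 'k mat) $$ (subset_index (?m + ?s) Z, subset_index (?n + ?t) W) =
      (bar a \<otimes>\<^sub>K bar b) $$ (subset_index (?m + ?s) Z, subset_index (?n + ?t) W)" .
qed

section \<open>Partitions as matrices over a semiring\<close>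

theorem proposition3p3:
  fixes n :: nat and a b :: partition
  shows "((bar a :: 'k::semiring_1 mat) = bar b \<longrightarrow> a = b)
    \<and> (bar (iota n) :: 'k mat) = 1\<^sub>m (2 ^ n)
    \<and> (bar (star a) :: 'k mat) = transpose_mat (bar a)
    \<and> (bar (a \<oplus>\<^sub>P b) :: 'k mat) = bar a \<otimes>\<^sub>K bar b"
  by (intro conjI impI bar_iota bar_star bar_oplus) (rule bar_inject)

end
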